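(* Let $A$ be a set, $\boxdot$ and $\boxplus$ binary hyperoperations on $A$, and $0\subset A$. Then $(A,\boxdot,\boxplus,0)$ is a hypersemiring if and only if $(\mathcal P(A),\bigcup,\boxdot,\boxplus,0)$ is a quantic semiring.
   Context: A binary hyperoperation on $A$ is a map $\star:A\times A\to\mathcal P(A)$ (the empty set is an allowed value); it is extended to $\mathcal P(A)$ by $S\star T=\bigcup_{s\in S,t\in T}s\star t$, and elements are identified with singletons. A hypersemigroup is a set with a binary hyperoperation $\boxdot$ with $a\boxdot(b\boxdot c)=(a\boxdot b)\boxdot c$ for all $a,b,c$. A hypermonoid is a hypersemigroup with a subset $1\subset A$ with $1\boxdot a=a\boxdot1=\{a\}$ for all $a$; it is commutative if $a\boxdot b=b\boxdot a$ for all $a,b$. A hypersemiring is a tuple $(A,\boxdot,\boxplus,0)$ such that: $(A,\boxdot)$ is a hypersemigroup; $(A,\boxplus,0)$ is a commutative hypermonoid with unit $0\subset A$; $a\boxdot(b\boxplus c)\subset(a\boxdot b)\boxplus(a\boxdot c)$ and $(a\boxplus b)\boxdot c\subset(a\boxdot c)\boxplus(b\boxdot c)$ for all $a,b,c\in A$; and $0\boxdot a\subset0$, $a\boxdot0\subset0$ for all $a\in A$. A quantale is a triple $(\mathcal Q,\bigvee,\cdot)$ where $(\mathcal Q,\bigvee)$ is a poset with all suprema and $\cdot$ is an associative multiplication distributing over arbitrary joins in each variable. A quantic semiring is a tuple $(\mathcal S,\bigvee,\cdot,+,0)$ such that: $(\mathcal S,\bigvee,\cdot)$ is a quantale; $(\mathcal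 S,+,0)$ is a commutative monoid; $+$ distributes over non-empty countable joins; $S\cdot(T+U)\le S\cdot T+S\cdot U$ and $(S+T)\cdot U\le S\cdot U+T\cdot U$ for all $S,T,U$; and $0\cdot S\le0$, $S\cdot0\le0$ for all $S$. Here $\mathcal P(A)$ is ordered by inclusion. *)

theory Defs
  imports "HOL-Algebra.Complete_Lattice" "HOL-Algebra.Group" "HOL-Library.Countable_Set"
begin

definition hyperoperation :: "'a set \<Rightarrow> ('a \<Rightarrow> 'a \<Rightarrow> 'a set) \<Rightarrow> bool" where
  "hyperoperation A h \<longleftrightarrow> h \<in> A \<rightarrow> A \<rightarrow> Pow A"

text \<open>The extension to subsets. An element \<open>a\<close> is identified with \<open>{a}\<close>, so that
  \<open>a \<star> (b \<star> c)\<close> is written \<open>hyper_ext h {a} (h b c)\<close>.\<close>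

definition hyper_ext :: "('a \<Rightarrow> 'a \<Rightarrow> 'a set) \<Rightarrow> 'a set \<Rightarrow> 'a set \<Rightarrow> 'a set" where
  "hyper_ext h S T = (\<Union>s\<in>S. \<Union>t\<in>T. h s t)"

locale hypersemigroup =
  fixes A :: "'a set" and h :: "'a \<Rightarrow> 'a \<Rightarrow> 'a set"
  assumes hyperop: "hyperoperation A h"
    and hyper_assoc: "\<lbrakk>a \<in> A; b \<in> A; c \<in> A\<rbrakk> \<Longrightarrow>
      hyper_ext h {a} (h b c) = hyper_ext h (h a b) {c}"

text \<open>The unit \<open>u\<close> is a subset of \<open>A\<close>, possibly with several elements.\<close>

locale hypermonoid = hypersemigroup A h
  for A :: "'a set" and h :: "'a \<Rightarrow> 'a \<Rightarrow> 'a set" +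
  fixes u :: "'a set"
  assumes unit_subset: "u \<subseteq> A"
    and unit_left: "a \<in> A \<Longrightarrow> hyper_ext h u {a} = {a}"
    and unit_right: "a \<in> A \<Longrightarrow> hyper_ext h {a} u = {a}"

locale comm_hypermonoid = hypermonoid A h u
  for A :: "'a set" and h :: "'a \<Rightarrow> 'a \<Rightarrow> 'a set" and u :: "'a set" +
  assumes hyper_comm: "\<lbrakk>a \<in> A; b \<in> A\<rbrakk> \<Longrightarrow> h a b = h b a"

locale hypersemiring =
  mult: hypersemigroup A mul + add: comm_hypermonoid A add zero
  for A :: "'a set" and mul add :: "'a \<Rightarrow> 'a \<Rightarrow> 'a set" and zero :: "'a set" +
  assumes subdistrib_left: "\<lbrakk>a \<in> A; b \<in> A; c \<in> A\<rbrakk> \<Longrightarrow>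
      hyper_ext mul {a} (add b c) \<subseteq> hyper_ext add (mul a b) (mul a c)"
    and subdistrib_right: "\<lbrakk>a \<in> A; b \<in> A; c \<in> A\<rbrakk> \<Longrightarrow>
      hyper_ext mul (add a b) {c} \<subseteq> hyper_ext add (mul a c) (mul b c)"
    and zero_mul: "a \<in> A \<Longrightarrow> hyper_ext mul zero {a} \<subseteq> zero"
    and mul_zero: "a \<in> A \<Longrightarrow> hyper_ext mul {a} zero \<subseteq> zero"

text \<open>The join is part of the data of a quantale; the axiom \<open>join_least\<close> says that it is the
  supremum for the given order. The join of the empty set is included, so \<open>mul\<close> preserves
  the bottom element.\<close>

locale quantale = partial_order L
  for L :: "('q, 'm) gorder_scheme" (structure) +
  fixes join :: "'q set \<Rightarrow> 'q" and mul :: "'q \<Rightarrow> 'q \<Rightarrow> 'q"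
  assumes join_least: "X \<subseteq> carrier L \<Longrightarrow> least L (join X) (Upper L X)"
    and mul_closed: "mul \<in> carrier L \<rightarrow> carrier L \<rightarrow> carrier L"
    and mul_assoc: "\<lbrakk>x \<in> carrier L; y \<in> carrier L; z \<in> carrier L\<rbrakk> \<Longrightarrow>
      mul (mul x y) z = mul x (mul y z)"
    and mul_join: "\<lbrakk>x \<in> carrier L; Y \<subseteq> carrier L\<rbrakk> \<Longrightarrow> mul x (join Y) = join (mul x ` Y)"
    and join_mul: "\<lbrakk>X \<subseteq> carrier L; y \<in> carrier L\<rbrakk> \<Longrightarrow>
      mul (join X) y = join ((\<lambda>x. mul x y) ` X)"

locale quantic_semiring = quantale L join mul
  for L :: "('q, 'm) gorder_scheme" (structure)
    and join :: "'q set \<Rightarrow> 'q" and mul :: "'q \<Rightarrow> 'q \<Rightarrow> 'q" +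
  fixes add :: "'q \<Rightarrow> 'q \<Rightarrow> 'q" and zero :: "'q"
  assumes add_comm_monoid: "comm_monoid \<lparr>carrier = carrier L, mult = add, one = zero\<rparr>"
    and add_join: "\<lbrakk>x \<in> carrier L; Y \<subseteq> carrier L; Y \<noteq> {}; countable Y\<rbrakk> \<Longrightarrow>
      add x (join Y) = join (add x ` Y)"
    and join_add: "\<lbrakk>X \<subseteq> carrier L; X \<noteq> {}; countable X; y \<in> carrier L\<rbrakk> \<Longrightarrow>
      add (join X) y = join ((\<lambda>x. add x y) ` X)"
    and subdistrib_left: "\<lbrakk>x \<in> carrier L; y \<in> carrier L; z \<in> carrier L\<rbrakk> \<Longrightarrow>
      mul x (add y z) \<sqsubseteq> add (mul x y) (mul x z)"
    and subdistrib_right: "\<lbrakk>x \<in> carrier L; y \<in> carrier L; z \<in> carrier L\<rbrakk> \<Longrightarrow>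
      mul (add x y) z \<sqsubseteq> add (mul x z) (mul y z)"
    and zero_mul: "x \<in> carrier L \<Longrightarrow> mul zero x \<sqsubseteq> zero"
    and mul_zero: "x \<in> carrier L \<Longrightarrow> mul x zero \<sqsubseteq> zero"

end

theory Submission
  imports Defs
begin

text \<open>\<open>hyper_ext h S T\<close> is a union of the values \<open>h s t\<close>, so it
  preserves unions in each variable and is determined by its values on singletons. An axiom whose
  two sides use each variable once, such as associativity or commutativity, therefore passes from
  elements to subsets: both sides expand into the same union of instances
  (\<open>hyper_ext_assoc\<close>, \<open>hyper_ext_comm\<close>). In subdistributivity one variable
  is repeated on the larger side, but an inclusion survives, because each elementwise right-hand
  side lies inside the one for subsets by monotonicity. Conversely, singletons of elements of
  \<open>A\<close> belong to \<open>Pow A\<close>, and there the axioms of a quantic semiring are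
  those of a hypersemiring.\<close>

lemma hyper_ext_singletons [simp]: "hyper_ext h {a} {b} = h a b"
  by (simp add: hyper_ext_def)

lemma hyper_ext_mono:
  "S \<subseteq> S' \<Longrightarrow> T \<subseteq> T' \<Longrightarrow> hyper_ext h S T \<subseteq> hyper_ext h S' T'"
  unfolding hyper_ext_def by blast

text \<open>With its companion this gives distributivity over joins; for an empty family both sides
  are empty.\<close>

lemma hyper_ext_Union_left: "hyper_ext h (\<Union>X) T = \<Union>((\<lambda>S. hyper_ext h S T) ` X)"
  unfolding hyper_ext_def by blast

lemma hyper_ext_Union_right: "hyper_ext h S (\<Union>Y) = \<Union>(hyper_ext h S ` Y)"
  unfolding hyper_ext_def by blast

lemma hyper_ext_UN_left: "hyper_ext h S T = (\<Union>s\<in>S. hyper_ext h {s} T)"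
  unfolding hyper_ext_def by blast

lemma hyper_ext_UN_right: "hyper_ext h S T = (\<Union>t\<in>T. hyper_ext h S {t})"
  unfolding hyper_ext_def by blast

text \<open>Brings an iterated product into the form of the elementwise axioms: the inner value
  \<open>k t u\<close> stays whole and only the outer arguments are split.\<close>

lemma hyper_ext_nested_right:
  "hyper_ext h S (hyper_ext k T U) = (\<Union>s\<in>S. \<Union>t\<in>T. \<Union>u\<in>U. hyper_ext h {s} (k t u))"
  unfolding hyper_ext_def by blast

lemma hyper_ext_nested_left:
  "hyper_ext h (hyper_ext k S T) U = (\<Union>s\<in>S. \<Union>t\<in>T. \<Union>u\<in>U. hyper_ext h (k s t) {u})"
  unfolding hyper_ext_def by blast

lemma hyper_ext_closed:
  "hyperoperation A h \<Longrightarrow> S \<subseteq> A \<Longrightarrow> T \<subseteq> A \<Longrightarrow> hyper_ext h S T \<subseteq> A"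
  unfolding hyperoperation_def hyper_ext_def Pi_iff Pow_iff by (intro UN_least) (meson subsetD)

lemma (in hypersemigroup) hyper_ext_assoc:
  assumes "S \<subseteq> A" "T \<subseteq> A" "U \<subseteq> A"
  shows "hyper_ext h (hyper_ext h S T) U = hyper_ext h S (hyper_ext h T U)"
  unfolding hyper_ext_nested_right hyper_ext_nested_left
  using assms by (intro SUP_cong refl hyper_assoc [symmetric]) auto

lemma (in comm_hypermonoid) hyper_ext_comm:
  assumes "S \<subseteq> A" "T \<subseteq> A"
  shows "hyper_ext h S T = hyper_ext h T S"
proof -
  have "hyper_ext h S T = (\<Union>s\<in>S. \<Union>t\<in>T. h t s)"
    unfolding hyper_ext_def using assms by (intro SUP_cong refl hyper_comm) auto
  also have "\<dots> = hyper_ext h T S"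
    unfolding hyper_ext_def by (rule SUP_commute)
  finally show ?thesis .
qed

text \<open>Only \<open>S\<close> is split into points. The unit \<open>u\<close> stays whole, since
  a single element of it may give the empty set when combined with a point.\<close>

lemma (in hypermonoid) hyper_ext_unit_left:
  assumes "S \<subseteq> A"
  shows "hyper_ext h u S = S"
  using assms unit_left by (subst hyper_ext_UN_right) auto

lemma (in comm_hypermonoid) comm_monoid_Pow:
  "comm_monoid \<lparr>carrier = Pow A, mult = hyper_ext h, one = u\<rparr>"
proof (rule comm_monoidI)
  fix S T
  assume "S \<in> carrier \<lparr>carrier = Pow A, mult = hyper_ext h, one = u\<rparr>"
    "T \<in> carrier \<lparr>carrier = Pow A, mult = hyper_ext h, one = u\<rparr>"
  then show "S \<otimes>\<^bsub>\<lparr>carrier = Pow A, mult = hyper_ext h, one = u\<rparr>\<^esub> T =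
      T \<otimes>\<^bsub>\<lparr>carrier = Pow A, mult = hyper_ext h, one = u\<rparr>\<^esub> S"
    by (simp add: hyper_ext_comm)
qed (simp_all add: hyper_ext_closed [OF hyperop] unit_subset hyper_ext_assoc hyper_ext_unit_left)

context hypersemiring
begin

text \<open>On the left one \<open>s\<close> serves both summands, while on the right the two copies
  of \<open>S\<close> are chosen from independently. Hence the elementwise inclusion is followed by
  an enlargement.\<close>

lemma hyper_ext_subdistrib_left:
  assumes "S \<subseteq> A" "T \<subseteq> A" "U \<subseteq> A"
  shows "hyper_ext mul S (hyper_ext add T U)
    \<subseteq> hyper_ext add (hyper_ext mul S T) (hyper_ext mul S U)"
proof (subst hyper_ext_nested_right, intro UN_least)
  fix s t u assume stu: "s \<in> S" "t \<in> T" "u \<in> U"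
  then have "hyper_ext mul {s} (add t u) \<subseteq> hyper_ext add (mul s t) (mul s u)"
    using assms by (intro subdistrib_left) auto
  also have "\<dots> \<subseteq> hyper_ext add (hyper_ext mul S T) (hyper_ext mul S U)"
    using stu by (intro hyper_ext_mono) (auto simp: hyper_ext_def)
  finally show "hyper_ext mul {s} (add t u) \<subseteq>
    hyper_ext add (hyper_ext mul S T) (hyper_ext mul S U)" .
qed

text \<open>The mirror image, with \<open>U\<close> as the repeated set.\<close>

lemma hyper_ext_subdistrib_right:
  assumes "S \<subseteq> A" "T \<subseteq> A" "U \<subseteq> A"
  shows "hyper_ext mul (hyper_ext add S T) U
    \<subseteq> hyper_ext add (hyper_ext mul S U) (hyper_ext mul T U)"
proof (subst hyper_ext_nested_left, intro UN_least)
  fix s t u assume stu: "s \<in> S" "t \<in> T" "u \<in> U"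
  then have "hyper_ext mul (add s t) {u} \<subseteq> hyper_ext add (mul s u) (mul t u)"
    using assms by (intro subdistrib_right) auto
  also have "\<dots> \<subseteq> hyper_ext add (hyper_ext mul S U) (hyper_ext mul T U)"
    using stu by (intro hyper_ext_mono) (auto simp: hyper_ext_def)
  finally show "hyper_ext mul (add s t) {u} \<subseteq>
    hyper_ext add (hyper_ext mul S U) (hyper_ext mul T U)" .
qed

lemma hyper_ext_zero_mul:
  assumes "S \<subseteq> A"
  shows "hyper_ext mul zero S \<subseteq> zero"
  using assms zero_mul by (subst hyper_ext_UN_right) blast

lemma hyper_ext_mul_zero:
  assumes "S \<subseteq> A"
  shows "hyper_ext mul S zero \<subseteq> zero"
  using assms mul_zero by (subst hyper_ext_UN_left) blast

end

lemma (in hypersemigroup) quantale_Pow: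
  "quantale \<lparr>carrier = Pow A, eq = (=), le = (\<subseteq>)\<rparr> \<Union> (hyper_ext h)"
proof -
  interpret P: partial_order "\<lparr>carrier = Pow A, eq = (=), le = (\<subseteq>)\<rparr>"
    by unfold_locales auto
  show ?thesis
  proof
    fix X assume "X \<subseteq> carrier \<lparr>carrier = Pow A, eq = (=), le = (\<subseteq>)\<rparr>"
    then show "least \<lparr>carrier = Pow A, eq = (=), le = (\<subseteq>)\<rparr> (\<Union>X)
        (Upper \<lparr>carrier = Pow A, eq = (=), le = (\<subseteq>)\<rparr> X)"
      by (intro least_UpperI) (fastforce simp: Upper_def)+
  qed (simp_all add: Pi_iff hyper_ext_closed [OF hyperop] hyper_ext_assoc
      hyper_ext_Union_left hyper_ext_Union_right)
qed

lemma (in hypersemiring) quantic_semiring_Pow: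
  "quantic_semiring \<lparr>carrier = Pow A, eq = (=), le = (\<subseteq>)\<rparr> \<Union>
    (hyper_ext mul) (hyper_ext add) zero"
  \<comment> \<open>The axioms on countable non-empty joins are instances of the two union
    lemmas.\<close>
  by (intro quantic_semiring.intro quantic_semiring_axioms.intro mult.quantale_Pow)
    (simp_all add: add.comm_monoid_Pow hyper_ext_Union_left hyper_ext_Union_right
      hyper_ext_subdistrib_left hyper_ext_subdistrib_right
      hyper_ext_zero_mul hyper_ext_mul_zero)

text \<open>Every axiom is read off at singletons, where \<open>hyper_ext_singletons\<close> turns
  the extended operation back into the hyperoperation. In the unit and absorption laws
  \<open>zero\<close> is already a member of \<open>Pow A\<close> and is left as it is.\<close>

lemma hypersemiring_of_quantic_semiring_Pow:
  assumes mul: "hyperoperation A mul" and add: "hyperoperation A add" and zero: "zero \<subseteq> A"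
    and Q: "quantic_semiring \<lparr>carrier = Pow A, eq = (=), le = (\<subseteq>)\<rparr> \<Union>
      (hyper_ext mul) (hyper_ext add) zero"
  shows "hypersemiring A mul add zero"
proof -
  interpret Q: quantic_semiring "\<lparr>carrier = Pow A, eq = (=), le = (\<subseteq>)\<rparr>" \<Union>
    "hyper_ext mul" "hyper_ext add" zero by (rule Q)
  interpret M: comm_monoid "\<lparr>carrier = Pow A, mult = hyper_ext add, one = zero\<rparr>"
    using Q.add_comm_monoid by simp
  show ?thesis
  proof
    fix a b c assume a: "a \<in> A" and b: "b \<in> A" and c: "c \<in> A"
    show "hyper_ext mul {a} (mul b c) = hyper_ext mul (mul a b) {c}"
      using Q.mul_assoc [of "{a}" "{b}" "{c}"] a b c by simp
    show "hyper_ext add {a} (add b c) = hyper_ext add (add a b) {c}"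
      using M.m_assoc [of "{a}" "{b}" "{c}"] a b c by simp
    show "hyper_ext mul {a} (add b c) \<subseteq> hyper_ext add (mul a b) (mul a c)"
      using Q.subdistrib_left [of "{a}" "{b}" "{c}"] a b c by simp
    show "hyper_ext mul (add a b) {c} \<subseteq> hyper_ext add (mul a c) (mul b c)"
      using Q.subdistrib_right [of "{a}" "{b}" "{c}"] a b c by simp
  next
    fix a b assume "a \<in> A" "b \<in> A"
    then show "add a b = add b a"
      using M.m_comm [of "{a}" "{b}"] by simp
  next
    fix a assume a: "a \<in> A"
    show "hyper_ext add zero {a} = {a}" using M.l_one [of "{a}"] a by simp
    show "hyper_ext add {a} zero = {a}" using M.r_one [of "{a}"] a by simp
    show "hyper_ext mul zero {a} \<subseteq> zero" using Q.zero_mul [of "{a}"] a by simp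
    show "hyper_ext mul {a} zero \<subseteq> zero" using Q.mul_zero [of "{a}"] a by simp
  \<comment> \<open>What remains is closure of the two hyperoperations and
    \<open>zero \<subseteq> A\<close>.\<close>
  qed (use mul add zero in auto)
qed

theorem proposition3p16:
  fixes A :: "'a set" and mul add :: "'a \<Rightarrow> 'a \<Rightarrow> 'a set" and zero :: "'a set"
  assumes "hyperoperation A mul" and "hyperoperation A add" and "zero \<subseteq> A"
  shows "hypersemiring A mul add zero \<longleftrightarrow>
    quantic_semiring \<lparr>carrier = Pow A, eq = (=), le = (\<subseteq>)\<rparr> \<Union>
      (hyper_ext mul) (hyper_ext add) zero"
  using hypersemiring.quantic_semiring_Pow hypersemiring_of_quantic_semiring_Pow [OF assms]
  by blast

end
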